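(* If an ordering $\preceq$ on a non-trivial countable group $\Gamma$ has trivial Conradian soul, then $\preceq$ is an accumulation point (in $\mathcal{O}(\Gamma)$) of its set of conjugates. In particular, the closure in $\mathcal{O}(\Gamma)$ of the orbit of $\preceq$ under the right (conjugacy) action of $\Gamma$ is homeomorphic to the Cantor set.
   Context: An ordering on a group $\Gamma$ is a left-invariant total order on $\Gamma$. $\mathcal{O}(\Gamma)$ denotes the set of all orderings on $\Gamma$, endowed with the topology having as sub-basis the sets $U_{f,g} = \{\preceq \,:\, f \prec g\}$, $f,g \in \Gamma$, $f\neq g$. The group $\Gamma$ acts on $\mathcal{O}(\Gamma)$ by conjugacy (equivalently, by right multiplication): for $f \in \Gamma$, the conjugate $\preceq_f$ of $\preceq$ is defined by $g \preceq_f h$ iff $fgf^{-1} \preceq fhf^{-1}$ (equivalently $gf^{-1} \preceq hf^{-1}$). An ordering $\preceq$ is Conradian if for all $f \succ id$, $g\succ id$ there exists $n\in\mathbb{N}$ with $fg^n\succ g$. A subgroup $\Gamma_*\subset\Gamma$ is $\preceq$-convex if $f\prec h\prec g$ with $f,g\in\Gamma_*$, $h \in \Gamma$, implies $h\in\Gamma_*$; it is $\preceq$-Conradian if the restriction of $\preceq$ to $\Gamma_*$ is Conradian. The Conradian soul of $\Gamma$ with respect to $\preceq$ is the maximal subgroup of $\Gamma$ that is simultaneously $\preceq$-convex and $\preceq$-Conradian (it exists since convex subgroups are linearly ordered by inclusion). *)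

theory Defs
  imports "HOL-Analysis.Analysis" "HOL-Algebra.Group"
begin

text \<open>
  An ordering is the set of pairs \<open>(x, y)\<close> with \<open>x \<preceq> y\<close>, a relation on \<open>carrier G\<close>.
\<close>

definition orderings :: "('a, 'b) monoid_scheme \<Rightarrow> 'a rel set" where
  "orderings G = {r. linear_order_on (carrier G) r \<and>
     (\<forall>f\<in>carrier G. \<forall>g\<in>carrier G. \<forall>h\<in>carrier G.
        (g, h) \<in> r \<longrightarrow> (f \<otimes>\<^bsub>G\<^esub> g, f \<otimes>\<^bsub>G\<^esub> h) \<in> r)}"

definition strictly_below :: "'a rel \<Rightarrow> 'a \<Rightarrow> 'a \<Rightarrow> bool" where
  "strictly_below r x y \<longleftrightarrow> (x, y) \<in> r \<and> x \<noteq> y"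

text \<open>
  If \<open>G\<close> is non-trivial, the sets \<open>{\<preceq>. f \<prec> g}\<close> already cover \<open>orderings G\<close>. The whole set is
  inserted so that the underlying set of the space is \<open>orderings G\<close> for the trivial group as well.
\<close>

definition ordering_space :: "('a, 'b) monoid_scheme \<Rightarrow> 'a rel topology" where
  "ordering_space G = topology_generated_by
     (insert (orderings G)
       {{r \<in> orderings G. strictly_below r f g} | f g. f \<in> carrier G \<and> g \<in> carrier G \<and> f \<noteq> g})"

definition conjugate_ordering :: "('a, 'b) monoid_scheme \<Rightarrow> 'a \<Rightarrow> 'a rel \<Rightarrow> 'a rel" where
  "conjugate_ordering G f r = {(g, h). g \<in> carrier G \<and> h \<in> carrier G \<and>
     (f \<otimes>\<^bsub>G\<^esub> g \<otimes>\<^bsub>G\<^esub> inv\<^bsub>G\<^esub> f, f \<otimes>\<^bsub>G\<^esub> h \<otimes>\<^bsub>G\<^esub> inv\<^bsub>G\<^esub> f) \<in> r}"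

definition conjugates :: "('a, 'b) monoid_scheme \<Rightarrow> 'a rel \<Rightarrow> 'a rel set" where
  "conjugates G r = (\<lambda>f. conjugate_ordering G f r) ` carrier G"

definition conradian :: "('a, 'b) monoid_scheme \<Rightarrow> 'a rel \<Rightarrow> bool" where
  "conradian G r \<longleftrightarrow>
     (\<forall>f\<in>carrier G. \<forall>g\<in>carrier G.
        strictly_below r \<one>\<^bsub>G\<^esub> f \<longrightarrow> strictly_below r \<one>\<^bsub>G\<^esub> g \<longrightarrow>
        (\<exists>n::nat. strictly_below r g (f \<otimes>\<^bsub>G\<^esub> g [^]\<^bsub>G\<^esub> n)))"

definition convex_in_ordering :: "('a, 'b) monoid_scheme \<Rightarrow> 'a rel \<Rightarrow> 'a set \<Rightarrow> bool" where
  "convex_in_ordering G r H \<longleftrightarrow>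
     (\<forall>f\<in>H. \<forall>g\<in>H. \<forall>h\<in>carrier G. strictly_below r f h \<longrightarrow> strictly_below r h g \<longrightarrow> h \<in> H)"

definition convex_conradian_subgroup :: "('a, 'b) monoid_scheme \<Rightarrow> 'a rel \<Rightarrow> 'a set \<Rightarrow> bool" where
  "convex_conradian_subgroup G r H \<longleftrightarrow>
     subgroup H G \<and> convex_in_ordering G r H \<and> conradian (G\<lparr>carrier := H\<rparr>) (Restr r H)"

text \<open>
  \<open>GREATEST\<close> is taken with respect to \<open>\<subseteq>\<close>. For every ordering the greatest such subgroup exists,
  because convex subgroups are linearly ordered by inclusion.
\<close>

definition conradian_soul :: "('a, 'b) monoid_scheme \<Rightarrow> 'a rel \<Rightarrow> 'a set" where
  "conradian_soul G r = (GREATEST H. convex_conradian_subgroup G r H)"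

lemma convex_subgroups_chain:
  fixes G (structure)
  assumes "group G" and r: "r \<in> orderings G"
    and H: "subgroup H G" "convex_in_ordering G r H"
    and K: "subgroup K G" "convex_in_ordering G r K"
  shows "H \<subseteq> K \<or> K \<subseteq> H"
proof (rule disjCI)
  assume "\<not> K \<subseteq> H"
  interpret group G by fact
  have lin: "linear_order_on (carrier G) r"
    and left: "\<And>f g h. f \<in> carrier G \<Longrightarrow> g \<in> carrier G \<Longrightarrow> h \<in> carrier G \<Longrightarrow> (g, h) \<in> r \<Longrightarrow>
      (f \<otimes> g, f \<otimes> h) \<in> r"
    using r unfolding orderings_def by auto
  have total: "(x, y) \<in> r \<or> (y, x) \<in> r" if "x \<in> carrier G" "y \<in> carrier G" for x y
    using lin that unfolding order_on_defs refl_on_def total_on_def by (cases "x = y") auto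
  have inv_pos: "(\<one>, inv x) \<in> r" if "x \<in> carrier G" "(\<one>, x) \<notin> r" for x
    using left[of "inv x" x "\<one>"] total[of x "\<one>"] that by auto
  obtain k0 where k0: "k0 \<in> K" "k0 \<notin> H" using \<open>\<not> K \<subseteq> H\<close> by blast
  obtain k where k: "k \<in> K" "k \<notin> H" "(\<one>, k) \<in> r"
  proof (cases "(\<one>, k0) \<in> r")
    case True
    then show ?thesis using k0 that by blast
  next
    case False
    have k0c: "k0 \<in> carrier G" using k0 K(1) subgroup.mem_carrier by metis
    have "inv k0 \<notin> H"
      using k0 H(1) k0c subgroup.m_inv_closed[of H G "inv k0"] by auto
    moreover have "inv k0 \<in> K" using k0 K(1) subgroup.m_inv_closed by metis
    ultimately show ?thesis using that inv_pos[OF k0c False] by blast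
  qed
  have kc: "k \<in> carrier G" using k K(1) subgroup.mem_carrier by metis
  have pos: "x \<in> K" if x: "x \<in> H" "(\<one>, x) \<in> r" for x
  proof -
    have xc: "x \<in> carrier G" using x H(1) subgroup.mem_carrier by metis
    have one: "\<one> \<in> H" "\<one> \<in> K" using H(1) K(1) subgroup.one_closed by auto
    have "(k, x) \<notin> r"
    proof
      assume kx: "(k, x) \<in> r"
      moreover have "k \<noteq> \<one>" "k \<noteq> x" using k one x by auto
      ultimately show False
        using k x one kc H(2) unfolding convex_in_ordering_def strictly_below_def by blast
    qed
    then have xk: "(x, k) \<in> r" using total[OF kc xc] by blast
    show ?thesis
    proof (cases "x = \<one> \<or> x = k")
      case True
      then show ?thesis using one k by auto
    next
      case False
      then have "strictly_below r \<one> x" "strictly_below r x k"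
        using xk x unfolding strictly_below_def by auto
      then show ?thesis using one k xc K(2) unfolding convex_in_ordering_def by blast
    qed
  qed
  show "H \<subseteq> K"
  proof
    fix x assume x: "x \<in> H"
    have xc: "x \<in> carrier G" using x H(1) subgroup.mem_carrier by metis
    show "x \<in> K"
    proof (cases "(\<one>, x) \<in> r")
      case True
      then show ?thesis using pos x by blast
    next
      case False
      then have "inv x \<in> K"
        using inv_pos[OF xc] pos x H(1) subgroup.m_inv_closed by metis
      then have "inv (inv x) \<in> K" using K(1) subgroup.m_inv_closed by metis
      then show ?thesis using xc by simp
    qed
  qed
qed

lemma conradian_soul_greatest:
  fixes G (structure)
  assumes "group G" and r: "r \<in> orderings G"
  shows "convex_conradian_subgroup G r (conradian_soul G r)"
    and "convex_conradian_subgroup G r H \<Longrightarrow> H \<subseteq> conradian_soul G r"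
proof -
  interpret group G by fact
  define F where "F = {H. convex_conradian_subgroup G r H}"
  have antisym: "antisym r" using r unfolding orderings_def order_on_defs by auto
  have FD: "subgroup H G" "convex_in_ordering G r H" "conradian (G\<lparr>carrier := H\<rparr>) (Restr r H)"
    if "H \<in> F" for H
    using that unfolding F_def convex_conradian_subgroup_def by auto
  have "{\<one>} \<in> F"
    using triv_subgroup antisym
    unfolding F_def convex_conradian_subgroup_def convex_in_ordering_def conradian_def
      strictly_below_def antisym_def by auto
  then have ne: "\<one> \<in> \<Union>F" by blast
  have common: "\<exists>H\<in>F. x \<in> H \<and> y \<in> H" if "x \<in> \<Union>F" "y \<in> \<Union>F" for x y
    using that convex_subgroups_chain[OF assms] FD by (meson UnionE subsetD)
  have sub: "subgroup (\<Union>F) G"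
  proof (rule subgroupI)
    show "\<Union>F \<subseteq> carrier G" using FD(1) subgroup.subset by blast
    show "\<Union>F \<noteq> {}" using ne by blast
    show "inv a \<in> \<Union>F" if "a \<in> \<Union>F" for a
      using that FD(1) subgroup.m_inv_closed by (metis UnionE UnionI)
    show "a \<otimes> b \<in> \<Union>F" if "a \<in> \<Union>F" "b \<in> \<Union>F" for a b
      using common[OF that] FD(1) subgroup.m_closed by (metis UnionI)
  qed
  have conv: "convex_in_ordering G r (\<Union>F)"
    unfolding convex_in_ordering_def
  proof (intro ballI impI)
    fix f g h assume a: "f \<in> \<Union>F" "g \<in> \<Union>F" "h \<in> carrier G" "strictly_below r f h" "strictly_below r h g"
    obtain H where "H \<in> F" "f \<in> H" "g \<in> H" using common[OF a(1,2)] by blast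
    then show "h \<in> \<Union>F" using FD(2) a(3-5) unfolding convex_in_ordering_def by blast
  qed
  have conr: "conradian (G\<lparr>carrier := \<Union>F\<rparr>) (Restr r (\<Union>F))"
    unfolding conradian_def
  proof (intro ballI impI)
    fix f g assume "f \<in> carrier (G\<lparr>carrier := \<Union>F\<rparr>)" "g \<in> carrier (G\<lparr>carrier := \<Union>F\<rparr>)"
      and s: "strictly_below (Restr r (\<Union>F)) \<one>\<^bsub>G\<lparr>carrier := \<Union>F\<rparr>\<^esub> f"
             "strictly_below (Restr r (\<Union>F)) \<one>\<^bsub>G\<lparr>carrier := \<Union>F\<rparr>\<^esub> g"
    then obtain H where H: "H \<in> F" "f \<in> H" "g \<in> H" using common[of f g] by auto
    have "\<one> \<in> H" using FD(1)[OF H(1)] subgroup.one_closed by blast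
    then have "strictly_below (Restr r H) \<one> f" "strictly_below (Restr r H) \<one> g"
      using s H unfolding strictly_below_def by auto
    then obtain n :: nat where
      "strictly_below (Restr r H) g (f \<otimes> g [^]\<^bsub>G\<lparr>carrier := H\<rparr>\<^esub> n)"
      using FD(3)[OF H(1)] H unfolding conradian_def by auto
    moreover have "g [^]\<^bsub>G\<lparr>carrier := H\<rparr>\<^esub> n = g [^] n"
      "g [^]\<^bsub>G\<lparr>carrier := \<Union>F\<rparr>\<^esub> n = g [^] n"
      by (simp_all add: nat_pow_def)
    ultimately have "strictly_below (Restr r (\<Union>F)) g (f \<otimes> g [^]\<^bsub>G\<lparr>carrier := \<Union>F\<rparr>\<^esub> n)"
      using H(1) unfolding strictly_below_def by auto
    then show "\<exists>n::nat. strictly_below (Restr r (\<Union>F)) g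
      (f \<otimes>\<^bsub>G\<lparr>carrier := \<Union>F\<rparr>\<^esub> g [^]\<^bsub>G\<lparr>carrier := \<Union>F\<rparr>\<^esub> n)" by auto
  qed
  have U: "convex_conradian_subgroup G r (\<Union>F)"
    using sub conv conr unfolding convex_conradian_subgroup_def by blast
  have max: "H \<subseteq> \<Union>F" if "convex_conradian_subgroup G r H" for H
    using that unfolding F_def by blast
  have eq: "conradian_soul G r = \<Union>F"
    unfolding conradian_soul_def using U max by (intro Greatest_equality) auto
  show "convex_conradian_subgroup G r (conradian_soul G r)" using U eq by simp
  show "convex_conradian_subgroup G r H \<Longrightarrow> H \<subseteq> conradian_soul G r" using max eq by simp
qed

lemma topspace_ordering_space: "topspace (ordering_space G) = orderings G"
  unfolding ordering_space_def by auto

lemma conjugates_subset_orderings: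
  fixes G (structure)
  assumes "group G" and r: "r \<in> orderings G"
  shows "conjugates G r \<subseteq> orderings G"
proof -
  interpret group G by fact
  have lin: "linear_order_on (carrier G) r"
    and left: "\<And>f g h. f \<in> carrier G \<Longrightarrow> g \<in> carrier G \<Longrightarrow> h \<in> carrier G \<Longrightarrow> (g, h) \<in> r \<Longrightarrow>
      (f \<otimes> g, f \<otimes> h) \<in> r"
    using r unfolding orderings_def by auto
  have "conjugate_ordering G f r \<in> orderings G" if f: "f \<in> carrier G" for f
  proof -
    let ?c = "\<lambda>x. f \<otimes> x \<otimes> inv f"
    have c: "?c x \<in> carrier G" if "x \<in> carrier G" for x using f that by auto
    have inj: "x = y" if "x \<in> carrier G" "y \<in> carrier G" "?c x = ?c y" for x y
      using f that by simp
    have "linear_order_on (carrier G) (conjugate_ordering G f r)"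
      unfolding order_on_defs
    proof (intro conjI)
      show "conjugate_ordering G f r \<subseteq> carrier G \<times> carrier G"
        unfolding conjugate_ordering_def by auto
      show "refl_on (carrier G) (conjugate_ordering G f r)"
        using lin c unfolding order_on_defs refl_on_def conjugate_ordering_def by auto
      show "trans (conjugate_ordering G f r)"
        using lin unfolding order_on_defs trans_def conjugate_ordering_def by blast
      show "antisym (conjugate_ordering G f r)"
        using lin inj unfolding order_on_defs antisym_def conjugate_ordering_def by blast
      show "total_on (carrier G) (conjugate_ordering G f r)"
        using lin inj c unfolding order_on_defs total_on_def conjugate_ordering_def by blast
    qed
    moreover have "(k \<otimes> g, k \<otimes> h) \<in> conjugate_ordering G f r"
      if k: "k \<in> carrier G" and gh: "(g, h) \<in> conjugate_ordering G f r" for k g h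
    proof -
      have mem: "g \<in> carrier G" "h \<in> carrier G" "(?c g, ?c h) \<in> r"
        using gh unfolding conjugate_ordering_def by auto
      have eq: "?c (k \<otimes> x) = ?c k \<otimes> ?c x" if "x \<in> carrier G" for x
      proof -
        have "?c k \<otimes> ?c x = f \<otimes> k \<otimes> (inv f \<otimes> (f \<otimes> (x \<otimes> inv f)))"
          using f k that by (simp add: m_assoc)
        also have "inv f \<otimes> (f \<otimes> (x \<otimes> inv f)) = x \<otimes> inv f"
          using f that by (simp add: m_assoc[symmetric])
        finally show ?thesis using f k that by (simp add: m_assoc)
      qed
      have "(?c k \<otimes> ?c g, ?c k \<otimes> ?c h) \<in> r"
        by (rule left[OF c[OF k] c[OF mem(1)] c[OF mem(2)] mem(3)])
      then show ?thesis
        using k mem eq unfolding conjugate_ordering_def by auto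
    qed
    ultimately show ?thesis unfolding orderings_def by blast
  qed
  then show ?thesis unfolding conjugates_def by auto
qed

text \<open>The ternary (middle-thirds) Cantor set.\<close>

fun cantor_stage :: "nat \<Rightarrow> real set" where
  "cantor_stage 0 = {0..1}"
| "cantor_stage (Suc n) =
     (\<lambda>x. x / 3) ` cantor_stage n \<union> (\<lambda>x. 2 / 3 + x / 3) ` cantor_stage n"

definition cantor_set :: "real set" where
  "cantor_set = (\<Inter>n. cantor_stage n)"

end

theory Submission
  imports Defs "HOL-Algebra.Generated_Groups"
begin

text \<open>
  If \<open>g\<close> is positive and \<open>\<one> \<preceq> x \<prec> g\<close>, then \<open>x \<prec> g \<preceq> g x\<close>, so \<open>g\<close> stays positive
  after conjugation by \<open>x\<inverse>\<close>. Every neighbourhood of \<open>\<preceq>\<close> thus contains the conjugates by the inverses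
  of all \<open>x\<close> in some interval \<open>[\<one>, g)\<close>. If all of these were equal to \<open>\<preceq>\<close>, then \<open>\<preceq>\<close> would be
  bi-invariant on the subgroup generated by \<open>[\<one>, g)\<close>; this subgroup would be convex and Conradian,
  hence trivial. But then \<open>g\<close> would be the least positive element, and the cyclic group it generates
  would be a non-trivial convex Conradian subgroup.

  Since conjugation acts by homeomorphisms, the orbit closure has no isolated points. The ordering
  space is compact, and for countable groups countably many clopen sets separate its points, so
  Brouwer's theorem applies.
\<close>

section \<open>Ternary expansions\<close>

definition ternary :: "(nat \<Rightarrow> bool) \<Rightarrow> real" where
  "ternary b = (\<Sum>k. 2 * of_bool (b k) / 3 ^ Suc k)"

lemma summable_ternary: "summable (\<lambda>k. 2 * of_bool (b k) / 3 ^ Suc k :: real)"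
proof (rule summable_comparison_test')
  show "summable (\<lambda>k. (2 / 3) * (1 / 3) ^ k :: real)"
    by (intro summable_mult summable_geometric) simp
  show "norm (2 * of_bool (b k) / 3 ^ Suc k :: real) \<le> (2 / 3) * (1 / 3) ^ k" if "k \<ge> 0" for k
    by (simp add: field_simps)
qed

text \<open>Removing the first digit leaves a third of the shifted expansion. This mirrors the
  recursion of \<open>cantor_stage\<close> and drives the inductions on digits below.\<close>

lemma ternary_split_head:
  "ternary b = (if b 0 then 2 / 3 else 0) + ternary (\<lambda>k. b (Suc k)) / 3"
proof -
  have "ternary (\<lambda>k. b (Suc k)) / 3 = (\<Sum>k. 2 * of_bool (b (Suc k)) / 3 ^ Suc k / 3)"
    unfolding ternary_def by (rule suminf_divide[OF summable_ternary, symmetric])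
  also have "\<dots> = (\<Sum>k. 2 * of_bool (b (Suc k)) / 3 ^ Suc (Suc k))"
    by (simp add: field_simps)
  also have "\<dots> = ternary b - 2 * of_bool (b 0) / 3 ^ Suc 0"
    unfolding ternary_def by (rule suminf_split_head[OF summable_ternary])
  finally show ?thesis by (cases "b 0") (simp_all add: field_simps)
qed

lemma ternary_bounds: "0 \<le> ternary b" "ternary b \<le> 1"
proof -
  show "0 \<le> ternary b"
    unfolding ternary_def by (intro suminf_nonneg summable_ternary) simp
  have "(\<lambda>k. (2 / 3) * (1 / 3) ^ k :: real) sums ((2 / 3) * (1 / (1 - 1 / 3)))"
    by (intro sums_mult geometric_sums) simp
  then have s: "(\<lambda>k. (2 / 3) * (1 / 3) ^ k :: real) sums 1" by simp
  have "ternary b \<le> (\<Sum>k. (2 / 3) * (1 / 3) ^ k)"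
    unfolding ternary_def using s
    by (intro suminf_le summable_ternary) (auto simp: sums_iff field_simps)
  then show "ternary b \<le> 1" using s by (simp add: sums_iff)
qed

lemma ternary_in_cantor_stage: "ternary b \<in> cantor_stage n"
proof (induction n arbitrary: b)
  case 0
  then show ?case using ternary_bounds by simp
next
  case (Suc n)
  then show ?case
    unfolding ternary_split_head[of b] by (cases "b 0") auto
qed

lemma ternary_in_cantor_set: "ternary b \<in> cantor_set"
  unfolding cantor_set_def using ternary_in_cantor_stage by blast

text \<open>Stage \<open>n\<close> fixes only \<open>n\<close> digits. That suffices for
  surjectivity onto the Cantor set once the image is known to be closed, so no point has to be
  expanded into all its digits.\<close>

lemma cantor_stage_ternary_approx:
  assumes "c \<in> cantor_stage n"
  shows "\<exists>b. \<forall>b'. (\<forall>k<n. b' k = b k) \<longrightarrow> \<bar>c - ternary b'\<bar> \<le> (1 / 3) ^ n"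
  using assms
proof (induction n arbitrary: c)
  case 0
  then have "\<bar>c - ternary b'\<bar> \<le> 1" for b'
    using ternary_bounds[of b'] by (auto simp: abs_le_iff)
  then show ?case by simp
next
  case (Suc n)
  \<comment> \<open>\<open>a\<close> records which of the two copies of the stage contains
    \<open>c\<close>; \<open>case_nat a b\<close> later puts it in front of the digits of
    \<open>d\<close>.\<close>
  then obtain d a where d: "d \<in> cantor_stage n" "c = (if a then 2 / 3 else 0) + d / 3"
    by (auto 0 3 intro: that[of _ True] that[of _ False])
  obtain b where b: "\<And>b'. (\<forall>k<n. b' k = b k) \<Longrightarrow> \<bar>d - ternary b'\<bar> \<le> (1 / 3) ^ n"
    using Suc.IH[OF d(1)] by blast
  have "\<bar>c - ternary b'\<bar> \<le> (1 / 3) ^ Suc n" if "\<forall>k<Suc n. b' k = case_nat a b k" for b'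
  proof -
    have h: "b' 0 = a" "\<forall>k<n. b' (Suc k) = b k" using that by force+
    have "c - ternary b' = (d - ternary (\<lambda>k. b' (Suc k))) / 3"
      unfolding ternary_split_head[of b'] d(2) h(1) by (simp add: field_simps)
    then have "\<bar>c - ternary b'\<bar> = \<bar>d - ternary (\<lambda>k. b' (Suc k))\<bar> / 3" by (simp only: abs_divide abs_numeral)
    then show ?thesis using b[of "\<lambda>k. b' (Suc k)"] h(2) by simp
  qed
  then show ?case by blast
qed

lemma ternary_dist_le:
  assumes "\<forall>k<n. b k = b' k"
  shows "\<bar>ternary b - ternary b'\<bar> \<le> (1 / 3) ^ n"
  using assms
proof (induction n arbitrary: b b')
  case 0
  show ?case using ternary_bounds[of b] ternary_bounds[of b'] by simp
next
  case (Suc n)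
  have eq: "ternary b - ternary b' = (ternary (\<lambda>k. b (Suc k)) - ternary (\<lambda>k. b' (Suc k))) / 3"
    using Suc.prems unfolding ternary_split_head[of b] ternary_split_head[of b']
    by (simp add: diff_divide_distrib)
  have "\<bar>ternary (\<lambda>k. b (Suc k)) - ternary (\<lambda>k. b' (Suc k))\<bar> \<le> (1 / 3) ^ n"
    using Suc.prems by (intro Suc.IH) simp
  then show ?case unfolding eq abs_divide by simp
qed

text \<open>Different leading digits differ in value by 2/3, and the tails can make up at most 1/3.
  So equal values force equal leading digits, and the comparison moves on to the shifted
  sequences.\<close>

lemma inj_ternary: "inj ternary"
proof (rule injI, rule ccontr)
  fix b b' assume eq: "ternary b = ternary b'" and "b \<noteq> b'"
  then obtain k where "b k \<noteq> b' k" by blast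
  then show False using eq
  proof (induction k arbitrary: b b')
    case 0
    then show False
      using ternary_bounds[of "\<lambda>k. b (Suc k)"] ternary_bounds[of "\<lambda>k. b' (Suc k)"]
      unfolding ternary_split_head[of b] ternary_split_head[of b'] by (auto split: if_splits)
  next
    case (Suc k)
    have "ternary (\<lambda>k. b (Suc k)) = ternary (\<lambda>k. b' (Suc k))"
      using Suc.prems(2) ternary_bounds[of "\<lambda>k. b (Suc k)"] ternary_bounds[of "\<lambda>k. b' (Suc k)"]
      unfolding ternary_split_head[of b] ternary_split_head[of b'] by (auto split: if_splits)
    then show False using Suc.IH[of "\<lambda>k. b (Suc k)" "\<lambda>k. b' (Suc k)"] Suc.prems(1) by blast
  qed
qed

section \<open>Brouwer's characterization of the Cantor set\<close>

text \<open>
  A point is determined by its bits \<open>P n x\<close>. Reading only the bits at the positions where the set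
  \<open>S\<close> of bit sequences branches along \<open>x\<close> turns a perfect compact \<open>S\<close> into the full binary tree.
\<close>

definition splitting :: "(nat \<Rightarrow> 'a \<Rightarrow> bool) \<Rightarrow> 'a set \<Rightarrow> 'a \<Rightarrow> nat set" where
  "splitting P S x = {n. \<exists>y\<in>S. (\<forall>m<n. P m y = P m x) \<and> P n y \<noteq> P n x}"

definition splitting_code :: "(nat \<Rightarrow> 'a \<Rightarrow> bool) \<Rightarrow> 'a set \<Rightarrow> 'a \<Rightarrow> nat \<Rightarrow> bool" where
  "splitting_code P S x k = P (enumerate (splitting P S x) k) x"

text \<open>Finding the k-th element of a set of naturals requires no knowledge beyond that element.
  Hence nearby points read the same positions in \<open>splitting_code\<close>.\<close>

lemma enumerate_cong_atMost:
  fixes A B :: "nat set"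
  assumes inf: "infinite A" "infinite B" and AB: "A \<inter> {..n} = B \<inter> {..n}"
    and "enumerate A k \<le> n"
  shows "enumerate B k = enumerate A k"
  using assms(4)
proof (induction k)
  case 0
  have A: "enumerate A 0 \<in> A" using inf enumerate_in_set by blast
  show ?case
    unfolding enumerate_0[of B]
  proof (rule Least_equality)
    show "enumerate A 0 \<in> B" using A AB 0 by blast
    show "enumerate A 0 \<le> y" if "y \<in> B" for y
    proof (cases "y \<le> n")
      case True
      then have "y \<in> A" using that AB by blast
      then show ?thesis by (simp add: enumerate_0 Least_le)
    qed (use 0 in simp)
  qed
next
  case (Suc k)
  have A: "enumerate A (Suc k) \<in> A" "enumerate A k < enumerate A (Suc k)"
    using inf enumerate_in_set enumerate_step by blast+
  have IH: "enumerate B k = enumerate A k" using Suc A by simp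
  show ?case
    unfolding enumerate_Suc''[OF inf(2)] IH
  proof (rule Least_equality)
    show "enumerate A (Suc k) \<in> B \<and> enumerate A k < enumerate A (Suc k)"
      using A AB Suc.prems by blast
    show "enumerate A (Suc k) \<le> y" if "y \<in> B \<and> enumerate A k < y" for y
    proof (cases "y \<le> n")
      case True
      then have "y \<in> A" using that AB by blast
      then show ?thesis using that by (simp add: enumerate_Suc''[OF inf(1)] Least_le)
    qed (use Suc.prems in simp)
  qed
qed

text \<open>A branch off \<open>x\<close> at a position where \<open>x\<close> and \<open>y\<close>
  still agree is also a branch off \<open>y\<close>. The bound \<open>n\<close> is included because,
  if they disagree there, each of the two points is a branch off the other.\<close>

lemma splitting_cong:
  assumes "x \<in> S" "y \<in> S" "\<forall>m<n. P m y = P m x"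
  shows "splitting P S x \<inter> {..n} = splitting P S y \<inter> {..n}"
proof -
  have *: "n' \<in> splitting P S v"
    if "u \<in> S" "v \<in> S" "\<forall>m<n. P m v = P m u" "n' \<in> splitting P S u" "n' \<le> n" for u v n'
  proof (cases "P n' v = P n' u")
    case True
    obtain z where "z \<in> S" "\<forall>m<n'. P m z = P m u" "P n' z \<noteq> P n' u"
      using \<open>n' \<in> splitting P S u\<close> unfolding splitting_def by blast
    then show ?thesis
      using that True unfolding splitting_def by (auto intro!: bexI[of _ z])
  next
    case False
    then show ?thesis
      using that unfolding splitting_def by (auto intro!: bexI[of _ u])
  qed
  show ?thesis using *[of x y] *[of y x] assms by auto
qed

text \<open>Perfectness supplies infinitely many branching positions along every point, so every
  finite code occurs and the image of \<open>F\<close> is dense in the Cantor set; being compact, it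
  is everything. A continuous injection from a compact space into a Hausdorff space is a
  homeomorphism onto its image.\<close>

lemma perfect_compact_homeomorphic_cantor_set:
  fixes X :: "'a topology" and P :: "nat \<Rightarrow> 'a \<Rightarrow> bool"
  assumes compact: "compact_space X" and nonempty: "topspace X \<noteq> {}"
    and clopen: "\<And>n. openin X {x \<in> topspace X. P n x}" "\<And>n. openin X {x \<in> topspace X. \<not> P n x}"
    and separating: "\<And>x y. x \<in> topspace X \<Longrightarrow> y \<in> topspace X \<Longrightarrow> x \<noteq> y \<Longrightarrow> \<exists>n. P n x \<noteq> P n y"
    and perfect: "\<And>x. x \<in> topspace X \<Longrightarrow> \<not> openin X {x}"
  shows "X homeomorphic_space top_of_set cantor_set"
proof -
  define S where "S = topspace X"
  define level where "level x = enumerate (splitting P S x)" for x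
  define code where "code = splitting_code P S"
  define F where "F x = ternary (code x)" for x
  define cyl where "cyl x n = {y \<in> S. \<forall>m<n. P m y = P m x}" for x n
  have code: "code x k = P (level x k) x" for x k
    unfolding code_def splitting_code_def level_def ..
  have open_cyl: "openin X (cyl x n)" for x n
  proof (induction n)
    case 0
    show ?case unfolding cyl_def S_def by simp
  next
    case (Suc n)
    have "openin X {y \<in> S. P n y = P n x}"
      using clopen[of n] unfolding S_def by (cases "P n x") auto
    moreover have "cyl x (Suc n) = cyl x n \<inter> {y \<in> S. P n y = P n x}"
      unfolding cyl_def by (auto simp: less_Suc_eq)
    ultimately show ?case using Suc by auto
  qed
  have first_difference: "\<exists>n \<in> splitting P S x. (\<forall>m<n. P m y = P m x) \<and> P n y \<noteq> P n x"
    if "x \<in> S" "y \<in> S" "x \<noteq> y" for x y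
  proof -
    define n where "n = (LEAST n. P n y \<noteq> P n x)"
    have "\<exists>n. P n y \<noteq> P n x" using separating[of y x] that unfolding S_def by blast
    then have "P n y \<noteq> P n x" unfolding n_def by (rule LeastI_ex)
    moreover have "\<forall>m<n. P m y = P m x" using not_less_Least unfolding n_def by blast
    ultimately show ?thesis unfolding splitting_def using that by blast
  qed
  \<comment> \<open>If branching along \<open>x\<close> ended before \<open>N\<close>, the open
    cylinder on the first \<open>N\<close> bits would contain only \<open>x\<close>.\<close>
  have inf: "infinite (splitting P S x)" if "x \<in> S" for x
  proof
    assume "finite (splitting P S x)"
    then obtain N where N: "\<forall>n \<in> splitting P S x. n < N"
      using finite_nat_set_iff_bounded by blast
    have "cyl x N = {x}"
    proof (intro equalityI subsetI)
      fix y assume y: "y \<in> cyl x N"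
      show "y \<in> {x}"
      proof (rule ccontr)
        assume "y \<notin> {x}"
        then have "x \<noteq> y" "y \<in> S" using y unfolding cyl_def by auto
        from first_difference[OF \<open>x \<in> S\<close> this(2,1)] show False
          using N y unfolding cyl_def by blast
      qed
    qed (use that in \<open>simp add: cyl_def\<close>)
    then show False using open_cyl[of x N] perfect[of x] that unfolding S_def by simp
  qed
  \<comment> \<open>The bits before \<open>level x k\<close> determine the splitting set up to and
    including that position, so \<open>i = k\<close> is allowed; the bit read there may still
    differ.\<close>
  have level_cong: "level y i = level x i" if "x \<in> S" "y \<in> cyl x (level x k)" "i \<le> k" for x y i k
    unfolding level_def
  proof (rule enumerate_cong_atMost)
    show "enumerate (splitting P S x) i \<le> level x k"
      unfolding level_def using that inf by simp
    show "splitting P S x \<inter> {..level x k} = splitting P S y \<inter> {..level x k}"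
      using that by (intro splitting_cong) (auto simp: cyl_def)
  qed (use that inf in \<open>auto simp: cyl_def\<close>)
  have code_cong: "code y i = code x i" if "x \<in> S" "y \<in> cyl x (level x k)" "i < k" for x y i k
  proof -
    have "level x i < level x k" unfolding level_def using that inf by simp
    then show ?thesis using level_cong[OF that(1,2), of i] that unfolding code cyl_def by simp
  qed
  have code_dense: "\<exists>x\<in>S. \<forall>k<n. code x k = b k" for b n
  proof (induction n)
    case 0
    then show ?case using nonempty unfolding S_def by blast
  next
    case (Suc n)
    then obtain x where x: "x \<in> S" "\<forall>k<n. code x k = b k" by blast
    show ?case
    proof (cases "code x n = b n")
      case True
      then show ?thesis using x by (auto simp: less_Suc_eq)
    next
      case False
      \<comment> \<open>A wrong code bit is repaired by moving to a point that branches off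
        \<open>x\<close> at exactly this level: the earlier code bits stay and bit \<open>n\<close>
        flips.\<close>
      have "level x n \<in> splitting P S x"
        unfolding level_def using inf[OF x(1)] enumerate_in_set by blast
      then obtain y where y: "y \<in> S" "\<forall>m<level x n. P m y = P m x" "P (level x n) y \<noteq> P (level x n) x"
        unfolding splitting_def by blast
      then have cyl: "y \<in> cyl x (level x n)" unfolding cyl_def by blast
      have "code y n = b n"
        using False y(3) level_cong[OF x(1) cyl, of n] unfolding code by auto
      moreover have "\<forall>k<n. code y k = b k" using code_cong[OF x(1) cyl] x(2) by simp
      ultimately show ?thesis using y(1) by (auto simp: less_Suc_eq)
    qed
  qed
  have cont: "continuous_map X euclideanreal F"
    unfolding continuous_map
  proof (intro conjI allI impI)
    fix U :: "real set" assume "openin euclideanreal U"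
    then have U: "open U" by simp
    show "openin X {x \<in> topspace X. F x \<in> U}"
    proof (subst openin_subopen, intro ballI)
      fix x assume "x \<in> {x \<in> topspace X. F x \<in> U}"
      then have x: "x \<in> S" "F x \<in> U" unfolding S_def by auto
      then obtain e where e: "e > 0" "ball (F x) e \<subseteq> U" using U open_contains_ball by blast
      obtain n where n: "(1 / 3 :: real) ^ n < e"
        using real_arch_pow_inv[OF e(1), of "1 / 3"] by auto
      have "F y \<in> U" if "y \<in> cyl x (level x n)" for y
      proof -
        have "\<bar>F x - F y\<bar> \<le> (1 / 3) ^ n"
          unfolding F_def using code_cong[OF x(1) that] by (intro ternary_dist_le) simp
        then have "F y \<in> ball (F x) e" using n by (simp add: dist_real_def)
        then show ?thesis using e by blast
      qed
      then show "\<exists>T. openin X T \<and> x \<in> T \<and> T \<subseteq> {x \<in> topspace X. F x \<in> U}"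
        using open_cyl[of x "level x n"] x by (intro exI[of _ "cyl x (level x n)"]) (auto simp: cyl_def S_def)
    qed
  qed simp
  have inj: "inj_on F S"
  proof (rule inj_onI, rule ccontr)
    fix x y assume xy: "x \<in> S" "y \<in> S" "F x = F y" "x \<noteq> y"
    obtain n where n: "n \<in> splitting P S x" "\<forall>m<n. P m y = P m x" "P n y \<noteq> P n x"
      using first_difference[OF xy(1,2,4)] by blast
    \<comment> \<open>The first difference is a splitting position of \<open>x\<close>, hence one
      that the code reads, and \<open>y\<close> reads it at the same index.\<close>
    obtain k where k: "level x k = n"
      using enumerate_Ex[OF inf[OF xy(1)] n(1)] unfolding level_def by blast
    have "y \<in> cyl x (level x k)" using n xy k unfolding cyl_def by blast
    from level_cong[OF xy(1) this, of k] have "code y k \<noteq> code x k"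
      using n(3) k unfolding code by simp
    then show False using xy(3) inj_ternary unfolding F_def inj_def by metis
  qed
  have "compactin euclideanreal (F ` S)"
    using image_compactin[OF _ cont] compact unfolding compact_space_def S_def by blast
  then have closed: "closed (F ` S)" by (simp add: compact_imp_closed)
  have "cantor_set \<subseteq> F ` S"
  proof
    fix c assume c: "c \<in> cantor_set"
    have "c \<in> closure (F ` S)"
      unfolding closure_approachable
    proof (intro allI impI)
      fix e :: real assume "e > 0"
      then obtain n where n: "(1 / 3 :: real) ^ n < e"
        using real_arch_pow_inv[of e "1 / 3"] by auto
      have "c \<in> cantor_stage n" using c unfolding cantor_set_def by blast
      then obtain b where b: "\<And>b'. (\<forall>k<n. b' k = b k) \<Longrightarrow> \<bar>c - ternary b'\<bar> \<le> (1 / 3) ^ n"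
        using cantor_stage_ternary_approx by blast
      obtain x where "x \<in> S" "\<forall>k<n. code x k = b k" using code_dense by blast
      then show "\<exists>y \<in> F ` S. dist y c < e"
        using b[of "code x"] n unfolding F_def dist_real_def by force
    qed
    then show "c \<in> F ` S" using closed by simp
  qed
  then have image: "F ` S = cantor_set" using ternary_in_cantor_set unfolding F_def by auto
  have "homeomorphic_map X (top_of_set cantor_set) F"
  proof (rule continuous_imp_homeomorphic_map)
    show "continuous_map X (top_of_set cantor_set) F"
      using cont image unfolding S_def continuous_map_in_subtopology by auto
    show "Hausdorff_space (top_of_set cantor_set)" by (simp add: Hausdorff_space_subtopology)
  qed (use compact image inj in \<open>auto simp: S_def\<close>)
  then show ?thesis by (rule homeomorphic_map_imp_homeomorphic_space)
qed

section \<open>The space of orderings\<close>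

lemma clopen_fun_bool:
  fixes p :: 'i
  shows closed_fun_bool: "closed {q. q p :: bool}" and open_fun_bool: "open {q. q p :: bool}"
proof -
  have c: "continuous_on UNIV (\<lambda>q :: 'i \<Rightarrow> bool. q p)"
    by (simp add: continuous_on_product_coordinates)
  have eq: "{q. q p :: bool} = (\<lambda>q. q p) -` {True}" by auto
  show "closed {q. q p :: bool}"
    unfolding eq using c by (intro closed_vimage) (auto simp: closed_def open_discrete)
  show "open {q. q p :: bool}"
    unfolding eq using c by (intro open_vimage) (auto simp: open_discrete)
qed

lemma compact_UNIV_fun_bool: "compact (UNIV :: ('i \<Rightarrow> bool) set)"
proof -
  have "compactin (product_topology (\<lambda>_::'i. euclidean :: bool topology) UNIV) (PiE UNIV (\<lambda>_. UNIV))"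
    by (simp only: compactin_PiE compactin_euclidean_iff finite finite_imp_compact simp_thms ball_UNIV)
  then show ?thesis by (simp add: euclidean_product_topology)
qed

lemma openin_strictly_below:
  assumes "f \<in> carrier G" "g \<in> carrier G"
  shows "openin (ordering_space G) {r \<in> orderings G. strictly_below r f g}"
proof (cases "f = g")
  case True
  then show ?thesis by (simp add: strictly_below_def)
next
  case False
  then show ?thesis
    unfolding ordering_space_def using assms by (intro topology_generated_by_Basis) blast
qed

text \<open>Totality and antisymmetry turn non-membership of a pair into a strict inequality, hence
  into an open condition.\<close>

lemma orderings_mem_iff:
  assumes "r \<in> orderings G" "f \<in> carrier G" "g \<in> carrier G"
  shows "(f, g) \<in> r \<longleftrightarrow> \<not> strictly_below r g f"
proof -
  have "refl_on (carrier G) r" "antisym r" "total_on (carrier G) r"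
    using assms(1) unfolding orderings_def order_on_defs by auto
  then show ?thesis
    using assms(2,3) unfolding strictly_below_def by (metis antisymD refl_onD total_on_def)
qed

text \<open>For fixed elements, each axiom constrains finitely many coordinates of the
  characteristic function, so the orderings form a closed set in a power of the two-point space. The
  space of orderings is a continuous image of it.\<close>

lemma compact_ordering_space: "compact_space (ordering_space G)"
proof -
  \<comment> \<open>Predicates on pairs replace relations, since function types carry the product
    topology.\<close>
  define K where "K = {q :: 'a \<times> 'a \<Rightarrow> bool. Collect q \<in> orderings G}"
  have "closed K"
    unfolding K_def orderings_def order_on_defs refl_on_def trans_def antisym_def total_on_def
      Ball_def subset_iff mem_Collect_eq
    by (intro closed_Collect_conj closed_Collect_all closed_Collect_imp closed_Collect_neg
        closed_Collect_disj closed_fun_bool open_fun_bool closed_Collect_const open_Collect_const)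
  then have "compactin euclidean K"
    using compact_UNIV_fun_bool closed_Int_compact[of K UNIV] by simp
  then have cK: "compact_space (top_of_set K)" by (rule compact_space_subtopology)
  have "continuous_map (top_of_set K) (ordering_space G) Collect"
    unfolding ordering_space_def
  proof (rule continuous_on_generated_topo)
    fix U
    assume "U \<in> insert (orderings G)
       {{r \<in> orderings G. strictly_below r f g} |f g. f \<in> carrier G \<and> g \<in> carrier G \<and> f \<noteq> g}"
    then consider "U = orderings G"
      | f g where "f \<noteq> g" "U = {r \<in> orderings G. strictly_below r f g}"
      by blast
    then show "openin (top_of_set K) (Collect -` U \<inter> topspace (top_of_set K))"
    proof cases
      case 1
      then have "Collect -` U \<inter> topspace (top_of_set K) = K" unfolding K_def by auto
      then show ?thesis by simp
    next
      case 2
      then have "Collect -` U \<inter> topspace (top_of_set K) = K \<inter> {q. q (f, g)}"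
        unfolding K_def strictly_below_def by auto
      then show ?thesis using openin_open_Int[OF open_fun_bool] by simp
    qed
  qed (auto simp: K_def)
  then have "compactin (ordering_space G) (Collect ` K)"
    using cK image_compactin unfolding compact_space_def by fastforce
  moreover have "Collect ` K = orderings G"
  proof
    show "orderings G \<subseteq> Collect ` K"
    proof
      fix r assume "r \<in> orderings G"
      then show "r \<in> Collect ` K" unfolding K_def by (intro image_eqI[of _ _ "\<lambda>p. p \<in> r"]) auto
    qed
  qed (auto simp: K_def)
  ultimately show ?thesis by (simp add: compact_space_def topspace_ordering_space)
qed

section \<open>Conjugates of a left-ordering\<close>

locale left_ordered_group = group G for G (structure) +
  fixes r :: "'a rel"
  assumes ordering: "r \<in> orderings G"
begin

abbreviation less (infix "\<sqsubset>" 50) where "x \<sqsubset> y \<equiv> strictly_below r x y"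
abbreviation leq (infix "\<sqsubseteq>" 50) where "x \<sqsubseteq> y \<equiv> (x, y) \<in> r"

lemma leq_refl [simp]: "x \<in> carrier G \<Longrightarrow> x \<sqsubseteq> x"
  and leq_trans: "x \<sqsubseteq> y \<Longrightarrow> y \<sqsubseteq> z \<Longrightarrow> x \<sqsubseteq> z"
  and leq_antisym: "x \<sqsubseteq> y \<Longrightarrow> y \<sqsubseteq> x \<Longrightarrow> x = y"
  and leq_left: "f \<in> carrier G \<Longrightarrow> x \<in> carrier G \<Longrightarrow> y \<in> carrier G \<Longrightarrow> x \<sqsubseteq> y \<Longrightarrow> f \<otimes> x \<sqsubseteq> f \<otimes> y"
  and leq_carrier: "x \<sqsubseteq> y \<Longrightarrow> x \<in> carrier G \<and> y \<in> carrier G"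
  using ordering unfolding orderings_def order_on_defs refl_on_def antisym_def
  by (auto dest: transD)

lemma not_leq_iff: "x \<in> carrier G \<Longrightarrow> y \<in> carrier G \<Longrightarrow> \<not> x \<sqsubseteq> y \<longleftrightarrow> y \<sqsubset> x"
  using orderings_mem_iff[OF ordering] by simp

lemma leq_less_trans: "x \<sqsubseteq> y \<Longrightarrow> y \<sqsubset> z \<Longrightarrow> x \<sqsubset> z"
  and less_leq_trans: "x \<sqsubset> y \<Longrightarrow> y \<sqsubseteq> z \<Longrightarrow> x \<sqsubset> z"
  unfolding strictly_below_def using leq_trans leq_antisym by blast+

lemma leq_left_iff:
  assumes "f \<in> carrier G" "x \<in> carrier G" "y \<in> carrier G"
  shows "f \<otimes> x \<sqsubseteq> f \<otimes> y \<longleftrightarrow> x \<sqsubseteq> y"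
  using leq_left[of f x y] leq_left[of "inv f" "f \<otimes> x" "f \<otimes> y"] assms
  by (auto simp: m_assoc[symmetric])

lemma less_left_iff:
  assumes "f \<in> carrier G" "x \<in> carrier G" "y \<in> carrier G"
  shows "f \<otimes> x \<sqsubset> f \<otimes> y \<longleftrightarrow> x \<sqsubset> y"
  using assms leq_left_iff unfolding strictly_below_def by simp

lemma one_less_inv_mult_iff:
  assumes "x \<in> carrier G" "y \<in> carrier G"
  shows "\<one> \<sqsubset> inv x \<otimes> y \<longleftrightarrow> x \<sqsubset> y" "\<one> \<sqsubseteq> inv x \<otimes> y \<longleftrightarrow> x \<sqsubseteq> y"
  using less_left_iff[of "inv x" x y] leq_left_iff[of "inv x" x y] assms by simp_all

lemma inv_leq_one: "\<one> \<sqsubseteq> x \<Longrightarrow> inv x \<sqsubseteq> \<one>"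
  using leq_left[of "inv x" \<one> x] leq_carrier[of \<one> x] by simp

lemma ex_positive:
  assumes "carrier G \<noteq> {\<one>}"
  shows "\<exists>g \<in> carrier G. \<one> \<sqsubset> g"
proof -
  obtain g where g: "g \<in> carrier G" "g \<noteq> \<one>" using assms by blast
  show ?thesis
  proof (cases "\<one> \<sqsubseteq> g")
    case True
    then show ?thesis using g unfolding strictly_below_def by metis
  next
    case False
    then have "g \<sqsubset> \<one>" using g not_leq_iff by blast
    then have "\<one> \<sqsubset> inv g" using one_less_inv_mult_iff(1)[of g \<one>] g by simp
    then show ?thesis using g by blast
  qed
qed

text \<open>The left factor \<open>inv x\<close> cancels by left invariance. So if this conjugation
  fixes \<open>r\<close>, then \<open>r\<close> is invariant under right multiplication by
  \<open>x\<close>.\<close>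

lemma conjugate_inv_iff:
  assumes "x \<in> carrier G" "f \<in> carrier G" "g \<in> carrier G"
  shows "(f, g) \<in> conjugate_ordering G (inv x) r \<longleftrightarrow> f \<otimes> x \<sqsubseteq> g \<otimes> x"
  using leq_left_iff[of "inv x" "f \<otimes> x" "g \<otimes> x"] assms
  unfolding conjugate_ordering_def by (simp add: m_assoc)

text \<open>Right invariance passes the initial-segment property from the generators to products,
  and left translation turns it into convexity. A bi-invariant ordering is Conradian with exponent
  1. This serves both for the elements from \<open>\<one>\<close> up to but excluding
  \<open>g\<close> and for a single least positive element.\<close>

lemma convex_conradian_generate:
  assumes A: "A \<subseteq> carrier G"
    and pos: "\<And>a. a \<in> A \<Longrightarrow> \<one> \<sqsubseteq> a"
    and initial: "\<And>a h. a \<in> A \<Longrightarrow> \<one> \<sqsubseteq> h \<Longrightarrow> h \<sqsubseteq> a \<Longrightarrow> h \<in> generate G A"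
    and right: "\<And>x y k. x \<in> generate G A \<Longrightarrow> y \<in> generate G A \<Longrightarrow> k \<in> generate G A \<Longrightarrow>
      x \<sqsubseteq> y \<Longrightarrow> x \<otimes> k \<sqsubseteq> y \<otimes> k"
  shows "convex_conradian_subgroup G r (generate G A)"
proof -
  define K where "K = generate G A"
  have K: "subgroup K G" unfolding K_def by (rule generate_is_subgroup[OF A])
  have Kc: "k \<in> carrier G" if "k \<in> K" for k using that K subgroup.mem_carrier by metis
  have one: "\<one> \<in> K" using K subgroup.one_closed by blast
  \<comment> \<open>Left translation reduces convexity to intervals starting at
    \<open>\<one>\<close>, which allows induction on how \<open>k\<close> is generated.\<close>
  have down: "h \<in> K" if "k \<in> K" "\<one> \<sqsubseteq> h" "h \<sqsubseteq> k" for h k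
    using that(1)[unfolded K_def] that(2,3)
  proof (induction k arbitrary: h rule: generate.induct)
    case one
    then show ?case using leq_antisym \<open>\<one> \<in> K\<close> by metis
  next
    case (incl a)
    then show ?case using initial unfolding K_def by blast
  next
    case (inv a)
    then have "h = \<one>" using pos inv_leq_one leq_trans leq_antisym by metis
    then show ?case using \<open>\<one> \<in> K\<close> by simp
  next
    case (eng k l)
    have kl: "k \<in> K" "l \<in> K" using eng unfolding K_def by auto
    note c = Kc[OF kl(1)] Kc[OF kl(2)]
    have hc: "h \<in> carrier G" using eng.prems leq_carrier by blast
    \<comment> \<open>If \<open>k \<sqsubseteq> \<one>\<close>, then \<open>k \<otimes> l\<close> is
      at most \<open>l\<close>; if \<open>h\<close> lies above \<open>k\<close>, translating by
      \<open>inv k\<close> puts it between \<open>\<one>\<close> and \<open>l\<close>. Each case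
      falls under an induction hypothesis.\<close>
    consider "h \<sqsubseteq> k" | "k \<sqsubseteq> \<one>" | "k \<sqsubseteq> h" "\<one> \<sqsubseteq> k"
      using not_leq_iff[of h k] not_leq_iff[of k \<one>] hc c unfolding strictly_below_def by blast
    then show ?case
    proof cases
      case 1
      then show ?thesis using eng by blast
    next
      case 2
      then have "k \<otimes> l \<sqsubseteq> \<one> \<otimes> l" using right kl one unfolding K_def by blast
      then have "h \<sqsubseteq> l" using eng.prems c leq_trans by auto
      then show ?thesis using eng by blast
    next
      case 3
      have "\<one> \<sqsubseteq> inv k \<otimes> h" using one_less_inv_mult_iff(2) 3 c hc by blast
      moreover have "inv k \<otimes> h \<sqsubseteq> l"
        using leq_left[of "inv k" h "k \<otimes> l"] eng.prems c hc by (simp add: m_assoc[symmetric])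
      ultimately have "inv k \<otimes> h \<in> K" using eng by blast
      then have "k \<otimes> (inv k \<otimes> h) \<in> K" using kl K subgroup.m_closed by metis
      then show ?thesis using c hc by (simp add: m_assoc[symmetric])
    qed
  qed
  have "convex_in_ordering G r K"
    unfolding convex_in_ordering_def
  proof (intro ballI impI)
    fix f g h assume a: "f \<in> K" "g \<in> K" "h \<in> carrier G" "f \<sqsubset> h" "h \<sqsubset> g"
    note c = Kc[OF a(1)] Kc[OF a(2)]
    have "inv f \<otimes> g \<in> K" using a K subgroup.m_closed subgroup.m_inv_closed by metis
    moreover have "\<one> \<sqsubseteq> inv f \<otimes> h" "inv f \<otimes> h \<sqsubseteq> inv f \<otimes> g"
      using a c one_less_inv_mult_iff(2) leq_left unfolding strictly_below_def by auto
    ultimately have "inv f \<otimes> h \<in> K" using down by blast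
    then have "f \<otimes> (inv f \<otimes> h) \<in> K" using a K subgroup.m_closed by metis
    then show "h \<in> K" using c a by (simp add: m_assoc[symmetric])
  qed
  moreover have "conradian (G\<lparr>carrier := K\<rparr>) (Restr r K)"
    unfolding conradian_def
  proof (intro ballI impI)
    fix f g
    assume "f \<in> carrier (G\<lparr>carrier := K\<rparr>)" "g \<in> carrier (G\<lparr>carrier := K\<rparr>)"
      and "strictly_below (Restr r K) \<one>\<^bsub>G\<lparr>carrier := K\<rparr>\<^esub> f"
    then have fg: "f \<in> K" "g \<in> K" "\<one> \<sqsubseteq> f" "f \<noteq> \<one>" unfolding strictly_below_def by auto
    have "\<one> \<otimes> g \<sqsubseteq> f \<otimes> g" using right fg one unfolding K_def by blast
    moreover have "f \<otimes> g \<in> K" using fg K subgroup.m_closed by metis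
    moreover have "g \<noteq> f \<otimes> g" using fg Kc r_cancel_one' by metis
    ultimately have "strictly_below (Restr r K) g (f \<otimes> g)"
      using fg Kc unfolding strictly_below_def by auto
    then show "\<exists>n::nat. strictly_below (Restr r K) g
        (f \<otimes>\<^bsub>G\<lparr>carrier := K\<rparr>\<^esub> g [^]\<^bsub>G\<lparr>carrier := K\<rparr>\<^esub> n)"
      using Kc fg by (intro exI[of _ 1]) (simp add: nat_pow_def)
  qed
  ultimately show ?thesis using K unfolding convex_conradian_subgroup_def K_def by blast
qed

lemma ex_small_nontrivial_conjugate:
  assumes soul: "conradian_soul G r = {\<one>}" and g: "g \<in> carrier G" "\<one> \<sqsubset> g"
  shows "\<exists>x. \<one> \<sqsubseteq> x \<and> x \<sqsubset> g \<and> conjugate_ordering G (inv x) r \<noteq> r"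
proof (rule ccontr)
  assume "\<not> ?thesis"
  then have fixed: "\<And>x. \<one> \<sqsubseteq> x \<Longrightarrow> x \<sqsubset> g \<Longrightarrow> conjugate_ordering G (inv x) r = r" by blast
  have trivial: "a = \<one>" if "convex_conradian_subgroup G r (generate G A)" "a \<in> A" for A a
    using conradian_soul_greatest(2)[OF is_group ordering that(1)] soul generate.incl[OF that(2)] by blast
  define A where "A = {x. \<one> \<sqsubseteq> x \<and> x \<sqsubset> g}"
  have A: "A \<subseteq> carrier G" unfolding A_def using leq_carrier by blast
  \<comment> \<open>Fixed conjugates give right invariance under elements of \<open>A\<close>. For
    an inverse generator the equivalence is read backwards, at points already multiplied by
    \<open>inv a\<close>; products follow by composition.\<close>
  have right: "x \<otimes> k \<sqsubseteq> y \<otimes> k \<longleftrightarrow> x \<sqsubseteq> y"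
    if "k \<in> generate G A" "x \<in> carrier G" "y \<in> carrier G" for x y k
    using that
  proof (induction k arbitrary: x y rule: generate.induct)
    case (incl a)
    then show ?case using conjugate_inv_iff[of a x y] fixed[of a] A unfolding A_def by auto
  next
    case (inv a)
    then have a: "a \<in> carrier G" using A by blast
    then show ?case
      using conjugate_inv_iff[of a "x \<otimes> inv a" "y \<otimes> inv a"] fixed[of a] inv
      unfolding A_def by (auto simp: m_assoc)
  next
    case (eng k l)
    have "k \<in> carrier G" "l \<in> carrier G" using eng.hyps generate_in_carrier[OF A] by auto
    then show ?case using eng by (simp add: m_assoc[symmetric])
  qed simp
  have "convex_conradian_subgroup G r (generate G A)"
  proof (rule convex_conradian_generate[OF A])
    show "h \<in> generate G A" if "a \<in> A" "\<one> \<sqsubseteq> h" "h \<sqsubseteq> a" for a h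
      using that leq_less_trans unfolding A_def by (intro generate.incl) blast
    show "x \<otimes> k \<sqsubseteq> y \<otimes> k"
      if "x \<in> generate G A" "y \<in> generate G A" "k \<in> generate G A" "x \<sqsubseteq> y" for x y k
      using that right generate_in_carrier[OF A] by blast
  qed (simp add: A_def)
  then have least: "x = \<one>" if "\<one> \<sqsubseteq> x" "x \<sqsubset> g" for x using that trivial unfolding A_def by blast
  \<comment> \<open>So \<open>g\<close> is the least positive element, and the cyclic group it generates is convex.\<close>
  have "convex_conradian_subgroup G r (generate G {g})"
  proof (rule convex_conradian_generate)
    show "\<one> \<sqsubseteq> a" if "a \<in> {g}" for a using that g unfolding strictly_below_def by blast
    show "h \<in> generate G {g}" if "a \<in> {g}" "\<one> \<sqsubseteq> h" "h \<sqsubseteq> a" for a h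
      using that least[of h] generate.intros(1,2) unfolding strictly_below_def by (metis singletonD)
    show "x \<otimes> k \<sqsubseteq> y \<otimes> k"
      if "x \<in> generate G {g}" "y \<in> generate G {g}" "k \<in> generate G {g}" "x \<sqsubseteq> y" for x y k
    proof -
      \<comment> \<open>A cyclic group is commutative, so right invariance follows from left
        invariance.\<close>
      have "u \<otimes> k = k \<otimes> u" if "u \<in> generate G {g}" for u
        using that \<open>k \<in> generate G {g}\<close> g(1)
        by (auto simp: generate_pow int_pow_mult[symmetric] add.commute)
      then show ?thesis using that leq_left generate_in_carrier[of "{g}"] g(1) by auto
    qed
  qed (use g in auto)
  then show False using trivial[of "{g}" g] g(2) unfolding strictly_below_def by blast
qed

lemma conjugates_accumulate:
  assumes "carrier G \<noteq> {\<one>}" "conradian_soul G r = {\<one>}"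
  shows "r \<in> ordering_space G derived_set_of conjugates G r"
  unfolding in_derived_set_of
proof (intro conjI allI impI)
  fix T assume T: "r \<in> T \<and> openin (ordering_space G) T"
  have "generate_topology_on (insert (orderings G)
       {{r \<in> orderings G. strictly_below r f g} | f g. f \<in> carrier G \<and> g \<in> carrier G \<and> f \<noteq> g}) T"
    using T unfolding ordering_space_def by (auto dest: openin_topology_generated_by)
  \<comment> \<open>A whole interval of conjugators is claimed, not a single one: bounds of this
    form survive intersections, where the smaller bound is kept, and leave room to choose a
    conjugate different from \<open>r\<close> at the end.\<close>
  then have "\<exists>g \<in> carrier G. \<one> \<sqsubset> g \<and> (\<forall>x. \<one> \<sqsubseteq> x \<longrightarrow> x \<sqsubset> g \<longrightarrow> conjugate_ordering G (inv x) r \<in> T)"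
    using conjunct1[OF T]
  proof (induction rule: generate_topology_on.induct)
    case (Int S T)
    then obtain g h where g: "g \<in> carrier G" "\<one> \<sqsubset> g"
        "\<And>x. \<one> \<sqsubseteq> x \<Longrightarrow> x \<sqsubset> g \<Longrightarrow> conjugate_ordering G (inv x) r \<in> S"
      and h: "h \<in> carrier G" "\<one> \<sqsubset> h"
        "\<And>x. \<one> \<sqsubseteq> x \<Longrightarrow> x \<sqsubset> h \<Longrightarrow> conjugate_ordering G (inv x) r \<in> T"
      by blast
    show ?case
    proof (cases "g \<sqsubseteq> h")
      case True
      then show ?thesis using g h(3) less_leq_trans by blast
    next
      case False
      then have "h \<sqsubseteq> g" using not_leq_iff g(1) h(1) unfolding strictly_below_def by blast
      then show ?thesis using h g(3) less_leq_trans by blast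
    qed
  next
    case (UN K)
    then obtain S where "S \<in> K" "r \<in> S" by blast
    then show ?case using UN.IH[of S] by blast
  next
    case (Basis S)
    have conj: "conjugate_ordering G (inv x) r \<in> orderings G" if "\<one> \<sqsubseteq> x" for x
      using conjugates_subset_orderings[OF is_group ordering] leq_carrier[OF that]
      unfolding conjugates_def by blast
    from Basis consider "S = orderings G"
      | f g where "f \<in> carrier G" "g \<in> carrier G" "f \<sqsubset> g" "S = {r \<in> orderings G. strictly_below r f g}"
      by blast
    then show ?case
    proof cases
      case 1
      \<comment> \<open>The full space imposes no condition, so any positive element is a bound;
        non-triviality provides one.\<close>
      then show ?thesis using ex_positive[OF assms(1)] conj by blast
    next
      case (2 f g)
      \<comment> \<open>The bound is \<open>inv f \<otimes> g\<close>, positive since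
        \<open>f \<sqsubset> g\<close>. An \<open>x\<close> below it is also below
        \<open>inv f \<otimes> g \<otimes> x\<close>; left multiplication by \<open>f\<close> gives
        the comparison.\<close>
      have "strictly_below (conjugate_ordering G (inv x) r) f g"
        if x: "\<one> \<sqsubseteq> x" "x \<sqsubset> inv f \<otimes> g" for x
      proof -
        have xc: "x \<in> carrier G" using x leq_carrier by blast
        have "inv f \<otimes> g \<sqsubseteq> inv f \<otimes> g \<otimes> x"
          using leq_left[of "inv f \<otimes> g" \<one> x] x(1) xc 2 by simp
        then have "x \<sqsubseteq> inv f \<otimes> g \<otimes> x"
          using less_leq_trans[OF x(2)] unfolding strictly_below_def by simp
        then have "f \<otimes> x \<sqsubseteq> g \<otimes> x"
          using leq_left[of f x "inv f \<otimes> g \<otimes> x"] xc 2 by (simp add: m_assoc[symmetric])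
        then have "(f, g) \<in> conjugate_ordering G (inv x) r"
          using conjugate_inv_iff[of x f g] xc 2 by simp
        then show ?thesis using \<open>f \<sqsubset> g\<close> unfolding strictly_below_def by simp
      qed
      then have "\<forall>x. \<one> \<sqsubseteq> x \<longrightarrow> x \<sqsubset> inv f \<otimes> g \<longrightarrow> conjugate_ordering G (inv x) r \<in> S"
        using conj unfolding \<open>S = _\<close> by simp
      moreover have "\<one> \<sqsubset> inv f \<otimes> g" using 2 one_less_inv_mult_iff(1) by simp
      ultimately show ?thesis using 2 by (intro bexI[of _ "inv f \<otimes> g"]) simp_all
    qed
  qed simp
  then obtain g where g: "g \<in> carrier G" "\<one> \<sqsubset> g"
    and small: "\<forall>x. \<one> \<sqsubseteq> x \<longrightarrow> x \<sqsubset> g \<longrightarrow> conjugate_ordering G (inv x) r \<in> T"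
    by (elim bexE conjE)
  obtain x where x: "\<one> \<sqsubseteq> x" "x \<sqsubset> g" "conjugate_ordering G (inv x) r \<noteq> r"
    using ex_small_nontrivial_conjugate[OF assms(2) g] by (elim exE conjE)
  then have "inv x \<in> carrier G" using leq_carrier[of \<one> x] by simp
  then show "\<exists>y. y \<noteq> r \<and> y \<in> conjugates G r \<and> y \<in> T"
    using small x unfolding conjugates_def by (intro exI[of _ "conjugate_ordering G (inv x) r"]) simp
qed (simp add: topspace_ordering_space ordering)

end

section \<open>The conjugation action and orbit closures\<close>

text \<open>Conjugation is a right action, so the inner conjugator becomes the left factor.\<close>

lemma (in group) conjugate_conjugate_ordering:
  assumes "f \<in> carrier G" "h \<in> carrier G"
  shows "conjugate_ordering G f (conjugate_ordering G h r) = conjugate_ordering G (h \<otimes> f) r"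
  using assms unfolding conjugate_ordering_def by (auto simp: m_assoc inv_mult_group)

lemma (in group) conjugate_ordering_one:
  assumes "r \<in> orderings G"
  shows "conjugate_ordering G \<one> r = r"
  using assms unfolding conjugate_ordering_def orderings_def order_on_defs by auto

lemma (in group) continuous_map_conjugate_ordering:
  assumes f: "f \<in> carrier G"
  shows "continuous_map (ordering_space G) (ordering_space G) (conjugate_ordering G f)"
proof -
  have orderings: "conjugate_ordering G f s \<in> orderings G" if "s \<in> orderings G" for s
    using conjugates_subset_orderings[OF is_group that] f unfolding conjugates_def by blast
  have "openin (ordering_space G)
      (conjugate_ordering G f -` U \<inter> topspace (ordering_space G))"
    if "U \<in> insert (orderings G)
       {{r \<in> orderings G. strictly_below r f g} | f g. f \<in> carrier G \<and> g \<in> carrier G \<and> f \<noteq> g}" for U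
  proof -
    from that consider "U = orderings G"
      | g h where "g \<in> carrier G" "h \<in> carrier G" "U = {r \<in> orderings G. strictly_below r g h}"
      by blast
    then show ?thesis
    proof cases
      case 1
      then have "conjugate_ordering G f -` U \<inter> topspace (ordering_space G) = topspace (ordering_space G)"
        using orderings by (auto simp: topspace_ordering_space)
      then show ?thesis by simp
    next
      case (2 g h)
      have "conjugate_ordering G f -` U \<inter> topspace (ordering_space G) =
          {r \<in> orderings G. strictly_below r (f \<otimes> g \<otimes> inv f) (f \<otimes> h \<otimes> inv f)}"
        using 2 f orderings
        by (auto simp: topspace_ordering_space strictly_below_def conjugate_ordering_def)
      then show ?thesis using openin_strictly_below[of _ G] 2 f by simp
    qed
  qed
  moreover have "conjugate_ordering G f ` orderings G \<subseteq> orderings G" using orderings by blast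
  ultimately show ?thesis
    using continuous_on_generated_topo_iff topspace_ordering_space[of G]
    unfolding ordering_space_def by (smt (verit) Union_upper insertI1 subset_trans)
qed

text \<open>An isolated point of the closure lies in the orbit, which is dense there. Conjugating it
  back to \<open>r\<close> would isolate \<open>r\<close> in its orbit, against
  accumulation.\<close>

lemma (in group) orbit_closure_no_isolated_point:
  assumes r: "r \<in> orderings G" and acc: "r \<in> ordering_space G derived_set_of conjugates G r"
    and s: "s \<in> ordering_space G closure_of conjugates G r"
  shows "\<not> openin (subtopology (ordering_space G) (ordering_space G closure_of conjugates G r)) {s}"
proof
  let ?Z = "ordering_space G closure_of conjugates G r"
  assume "openin (subtopology (ordering_space G) ?Z) {s}"
  then obtain U where U: "openin (ordering_space G) U" and UZ: "U \<inter> ?Z = {s}"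
    by (auto simp: openin_subtopology)
  have "conjugates G r \<subseteq> topspace (ordering_space G)"
    using conjugates_subset_orderings[OF is_group r] by (simp add: topspace_ordering_space)
  then have orbit: "conjugates G r \<subseteq> ?Z" by (rule closure_of_subset)
  have sU: "s \<in> U" using UZ by auto
  then obtain t where "t \<in> conjugates G r" "t \<in> U" using s U by (auto simp: in_closure_of)
  then have "t \<in> U \<inter> ?Z" using orbit by auto
  then have "s \<in> conjugates G r" using \<open>t \<in> conjugates G r\<close> unfolding UZ by simp
  then obtain f where f: "f \<in> carrier G" "s = conjugate_ordering G f r"
    by (auto simp: conjugates_def)
  \<comment> \<open>Pulling \<open>U\<close> back along the conjugation that sends \<open>r\<close>
    to \<open>s\<close> gives a neighbourhood of \<open>r\<close>, where the orbit must have a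
    second point.\<close>
  have "openin (ordering_space G) {t \<in> topspace (ordering_space G). conjugate_ordering G f t \<in> U}"
    by (rule openin_continuous_map_preimage[OF continuous_map_conjugate_ordering[OF f(1)] U])
  moreover have "r \<in> {t \<in> topspace (ordering_space G). conjugate_ordering G f t \<in> U}"
    using r f(2) sU by (simp add: topspace_ordering_space)
  ultimately have "\<exists>t. t \<noteq> r \<and> t \<in> conjugates G r \<and>
      t \<in> {t \<in> topspace (ordering_space G). conjugate_ordering G f t \<in> U}"
    using acc unfolding in_derived_set_of by (elim conjE allE impE) (rule conjI)
  then obtain t where t: "t \<noteq> r" "t \<in> conjugates G r" "conjugate_ordering G f t \<in> U"
    by auto
  obtain h where h: "h \<in> carrier G" "t = conjugate_ordering G h r"
    using t(2) by (auto simp: conjugates_def)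
  have "conjugate_ordering G f t = conjugate_ordering G (h \<otimes> f) r"
    using conjugate_conjugate_ordering f(1) h by simp
  then have "conjugate_ordering G f t \<in> U \<inter> ?Z"
    using orbit f(1) h(1) t(3) by (auto simp: conjugates_def)
  then have "conjugate_ordering G f t = conjugate_ordering G f r" unfolding UZ f(2) by simp
  then have "conjugate_ordering G (inv f) (conjugate_ordering G f t) =
      conjugate_ordering G (inv f) (conjugate_ordering G f r)" by simp
  moreover have "t \<in> orderings G" using t(2) conjugates_subset_orderings[OF is_group r] by auto
  ultimately have "t = r"
    using conjugate_conjugate_ordering[of "inv f" f] conjugate_ordering_one r f(1) by simp
  then show False using t(1) by simp
qed

theorem proposition4p7:
  fixes G (structure) and r :: "'a rel"
  assumes "group G"
    and "countable (carrier G)"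
    and "carrier G \<noteq> {\<one>}"
    and "r \<in> orderings G"
    and "conradian_soul G r = {\<one>}"
  shows "r \<in> ordering_space G derived_set_of conjugates G r \<and>
    subtopology (ordering_space G) (ordering_space G closure_of conjugates G r)
      homeomorphic_space top_of_set cantor_set"
proof
  interpret left_ordered_group G r
    using assms by (simp add: left_ordered_group_def left_ordered_group_axioms_def)
  show acc: "r \<in> ordering_space G derived_set_of conjugates G r"
    using conjugates_accumulate assms by blast
  let ?Z = "ordering_space G closure_of conjugates G r"
  let ?X = "subtopology (ordering_space G) ?Z"
  \<comment> \<open>Bit \<open>n\<close> of an ordering says whether it contains the pair
    \<open>e n\<close>; countability lets one sequence list all pairs.\<close>
  define e where "e = from_nat_into (carrier G \<times> carrier G)"
  have e: "range e = carrier G \<times> carrier G"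
    unfolding e_def using assms(2) by (intro range_from_nat_into) auto
  have ec: "fst (e n) \<in> carrier G" "snd (e n) \<in> carrier G" for n
    using rangeI[of e n] unfolding e by auto
  have Z: "?Z \<subseteq> orderings G"
    using closure_of_subset_topspace topspace_ordering_space by metis
  then have top: "topspace ?X = ?Z" by (auto simp: topspace_ordering_space)
  have compact: "compact_space ?X"
    by (intro compact_space_subtopology closedin_compact_space compact_ordering_space closedin_closure_of)
  have nonempty: "topspace ?X \<noteq> {}"
    unfolding top
    using subsetD[OF derived_set_of_subset_closure_of acc] by (metis emptyE)
  have open_less: "openin ?X (?Z \<inter> {s \<in> orderings G. strictly_below s (f n) (g n)})"
    if "\<And>n. f n \<in> carrier G" "\<And>n. g n \<in> carrier G" for f g :: "nat \<Rightarrow> 'a" and n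
    by (intro openin_subtopology_Int2 openin_strictly_below that)
  have closed: "openin ?X {s \<in> topspace ?X. e n \<notin> s}" for n
  proof -
    have "e n \<notin> s \<longleftrightarrow> strictly_below s (snd (e n)) (fst (e n))" if "s \<in> orderings G" for s
      using orderings_mem_iff[OF that ec(1)[of n] ec(2)[of n]] by simp
    then have "{s \<in> topspace ?X. e n \<notin> s} =
        ?Z \<inter> {s \<in> orderings G. strictly_below s (snd (e n)) (fst (e n))}"
      unfolding top using Z by auto
    then show ?thesis using open_less[of "\<lambda>n. snd (e n)" "\<lambda>n. fst (e n)" n] ec by simp
  qed
  \<comment> \<open>A diagonal pair lies in every ordering; off the diagonal, membership is the same
    as strict inequality.\<close>
  have "open": "openin ?X {s \<in> topspace ?X. e n \<in> s}" for n
  proof (cases "fst (e n) = snd (e n)")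
    case True
    have "e n \<in> s" if "s \<in> orderings G" for s
      using orderings_mem_iff[OF that ec(1)[of n] ec(2)[of n]] True
      unfolding strictly_below_def by (metis prod.collapse)
    then have "{s \<in> topspace ?X. e n \<in> s} = topspace ?X" unfolding top using Z by auto
    then show ?thesis using openin_topspace[of ?X] by metis
  next
    case False
    then have "{s \<in> topspace ?X. e n \<in> s} =
        ?Z \<inter> {s \<in> orderings G. strictly_below s (fst (e n)) (snd (e n))}"
      unfolding top using Z by (auto simp: strictly_below_def)
    then show ?thesis using open_less[of "\<lambda>n. fst (e n)" "\<lambda>n. snd (e n)" n] ec by simp
  qed
  have separating: "\<exists>n. (e n \<in> s) \<noteq> (e n \<in> t)"
    if "s \<in> topspace ?X" "t \<in> topspace ?X" "s \<noteq> t" for s t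
  proof -
    \<comment> \<open>Orderings consist of pairs of group elements, so two that agree on all
      \<open>e n\<close> are equal.\<close>
    have "u \<subseteq> range e" if "u \<in> ?Z" for u
      using subsetD[OF Z that] unfolding e orderings_def order_on_defs by simp
    then have "s \<subseteq> range e" "t \<subseteq> range e" using that(1,2) unfolding top by simp_all
    then show ?thesis using that(3) by blast
  qed
  have perfect: "\<not> openin ?X {s}" if "s \<in> topspace ?X" for s
    using orbit_closure_no_isolated_point[OF assms(4) acc] that unfolding top by simp
  show "?X homeomorphic_space top_of_set cantor_set"
    by (rule perfect_compact_homeomorphic_cantor_set[where P = "\<lambda>n s. e n \<in> s",
          OF compact nonempty "open" closed separating perfect])
qed

end
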